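(* For every $w\in\mathfrak{H}^0$, $$\overline{\Delta}(w)=s\circ(\widetilde\tau\otimes\widetilde\tau)\circ\Delta\circ\widetilde\tau(w),$$ where $s(a\otimes b)=b\otimes a$ is the flip.
   Context: Let $\mathfrak{H}=\mathbb{Q}\langle p,y\rangle$, $\mathfrak{H}^1=\mathbb{Q}\mathbf{1}\oplus\mathfrak{H}y$, $\mathfrak{H}^0=\mathbb{Q}\mathbf{1}\oplus p\mathfrak{H}y$, $z_k:=p^ky$ ($k\ge0$), so $\mathfrak{H}^1=\mathbb{Q}\langle z_k:k\ge0\rangle$. Let $\widetilde\tau$ be the anti-automorphism of $\mathfrak{H}$ with $\widetilde\tau(p)=y$, $\widetilde\tau(y)=p$. Let $\Delta\colon\mathfrak{H}^1\to\mathfrak{H}^1\otimes\mathfrak{H}^1$ be deconcatenation in the letters $z_k$: $\Delta(z_{k_1}\cdots z_{k_n})=\sum_{l=0}^{n}z_{k_1}\cdots z_{k_l}\otimes z_{k_{l+1}}\cdots z_{k_n}$ (empty products equal $\mathbf{1}$). Let $\mathcal{H}$ be the $\mathbb{Q}$-algebra spanned by words in the alphabet $\{p,d,y\}$ modulo $pd=dp=\mathbf{1}$ (concatenation product), which contains $\mathfrak{H}$. Let $\overline{\Delta}\colon\mathcal{H}\to\mathcal{H}\otimes\mathcal{H}$ be the linear map determined by $\overline{\Delta}(\mathbf{1})=\mathbf{1}\otimes\mathbf{1}$, $\overline{\Delta}(p)=p\otimes\mathbf{1}+\mathbf{1}\otimes p$, $\overline{\Delta}(y)=y\otimes\mathbf{1}$,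 $\overline{\Delta}(d)=0$ and $\overline{\Delta}(uv)=(u\otimes\mathbf{1})\overline{\Delta}(v)+\overline{\Delta}(u)(\mathbf{1}\otimes v)-u\otimes v$ for all $u,v\in\mathcal{H}$ (componentwise concatenation in $\mathcal{H}\otimes\mathcal{H}$). *)

theory Defs
  imports Complex_Main "HOL-Library.Poly_Mapping" "HOL-Library.Product_Plus"
begin

text \<open>
  The \<open>\<rat>\<close>-vector space with basis \<open>'a\<close> is \<open>'a \<Rightarrow>\<^sub>0 rat\<close>.  If \<open>'a\<close> is a monoid (written additively,
  not necessarily commutative), the convolution product of \<open>Poly_Mapping\<close> makes it the monoid
  algebra over \<open>\<rat>\<close>.
\<close>

definition qscale :: "rat \<Rightarrow> ('a \<Rightarrow>\<^sub>0 rat) \<Rightarrow> ('a \<Rightarrow>\<^sub>0 rat)" where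
  "qscale c = Poly_Mapping.map ((*) c)"

abbreviation qlinear :: "(('a \<Rightarrow>\<^sub>0 rat) \<Rightarrow> ('b \<Rightarrow>\<^sub>0 rat)) \<Rightarrow> bool" where
  "qlinear \<equiv> Vector_Spaces.linear qscale qscale"

abbreviation bas :: "'a \<Rightarrow> ('a \<Rightarrow>\<^sub>0 rat)" where
  "bas w \<equiv> Poly_Mapping.single w 1"

definition lin_ext :: "('a \<Rightarrow> ('b \<Rightarrow>\<^sub>0 rat)) \<Rightarrow> ('a \<Rightarrow>\<^sub>0 rat) \<Rightarrow> ('b \<Rightarrow>\<^sub>0 rat)" where
  "lin_ext f a = (\<Sum>w\<in>Poly_Mapping.keys a. qscale (Poly_Mapping.lookup a w) (f w))"

lemma lookup_qscale [simp]:
  "Poly_Mapping.lookup (qscale c a) w = c * Poly_Mapping.lookup a w"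
  unfolding qscale_def by transfer (auto simp: when_def)

lemma qscale_conv_mult: "qscale c a = Poly_Mapping.single 0 c * (a :: 'a::monoid_add \<Rightarrow>\<^sub>0 rat)"
  by (simp add: qscale_def mult_map_scale_conv_mult)

lemma qscale_single [simp]: "qscale c (Poly_Mapping.single w x) = Poly_Mapping.single w (c * x)"
  by (rule poly_mapping_eqI) (simp add: lookup_single when_def)

lemma vector_space_qscale: "vector_space (qscale :: rat \<Rightarrow> ('a \<Rightarrow>\<^sub>0 rat) \<Rightarrow> _)"
  by unfold_locales (auto intro!: poly_mapping_eqI simp: lookup_add algebra_simps)

lemma qlinear_iff:
  "qlinear f \<longleftrightarrow> (\<forall>a b. f (a + b) = f a + f b) \<and> (\<forall>c a. f (qscale c a) = qscale c (f a))"
  by (auto simp: linear_iff_module_hom module_hom_iff module_iff_vector_space vector_space_qscale)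

lemma qlinear_sum: "qlinear f \<Longrightarrow> f (sum g A) = (\<Sum>x\<in>A. f (g x))"
  by (simp add: linear_iff_module_hom module_hom.sum)

lemma qlinear_diff: "qlinear f \<Longrightarrow> f (a - b) = f a - f b"
  by (simp add: linear_iff_module_hom module_hom.diff)

lemma sum_bas: "(\<Sum>w\<in>Poly_Mapping.keys a. qscale (Poly_Mapping.lookup a w) (bas w)) = a"
  by (rule poly_mapping_eqI)
     (auto simp: lookup_sum lookup_single when_def sum.delta in_keys_iff)

lemma lin_ext_superset:
  assumes "finite S" "Poly_Mapping.keys a \<subseteq> S"
  shows "lin_ext f a = (\<Sum>w\<in>S. qscale (Poly_Mapping.lookup a w) (f w))"
  unfolding lin_ext_def using assms
  by (intro sum.mono_neutral_left) (auto intro!: poly_mapping_eqI simp: in_keys_iff)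

lemma qlinear_lin_ext: "qlinear (lin_ext f)"
proof -
  have "lin_ext f (a + b) = lin_ext f a + lin_ext f b" for a b
  proof -
    let ?S = "Poly_Mapping.keys a \<union> Poly_Mapping.keys b"
    have "Poly_Mapping.keys (a + b) \<subseteq> ?S" by (rule keys_add)
    then show ?thesis
      by (intro poly_mapping_eqI)
         (simp add: lin_ext_superset[of ?S] lookup_sum lookup_add sum.distrib algebra_simps)
  qed
  moreover have "lin_ext f (qscale c a) = qscale c (lin_ext f a)" for c a
  proof -
    have "Poly_Mapping.keys (qscale c a) \<subseteq> Poly_Mapping.keys a" by (auto simp: in_keys_iff)
    then show ?thesis
      by (intro poly_mapping_eqI)
         (simp add: lin_ext_superset[of "Poly_Mapping.keys a"] lookup_sum sum_distrib_left mult.assoc)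
  qed
  ultimately show ?thesis by (simp add: qlinear_iff)
qed

lemma lin_ext_bas [simp]: "lin_ext f (bas w) = f w"
  by (auto intro!: poly_mapping_eqI simp: lin_ext_def)

lemma qlinear_ext:
  assumes "qlinear f" "qlinear g" "\<And>w. f (bas w) = g (bas w)"
  shows "f = g"
proof
  fix a
  have "f a = (\<Sum>w\<in>Poly_Mapping.keys a. qscale (Poly_Mapping.lookup a w) (f (bas w)))"
    by (subst (1) sum_bas[of a, symmetric], subst qlinear_sum[OF assms(1)])
       (use assms(1) in \<open>simp add: qlinear_iff del: qscale_single\<close>)
  also have "\<dots> = (\<Sum>w\<in>Poly_Mapping.keys a. qscale (Poly_Mapping.lookup a w) (g (bas w)))"
    by (simp add: assms(3))
  also have "\<dots> = g a"
    by (subst (3) sum_bas[of a, symmetric], subst qlinear_sum[OF assms(2)])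
       (use assms(2) in \<open>simp add: qlinear_iff del: qscale_single\<close>)
  finally show "f a = g a" .
qed


section \<open>Tensor products\<close>

text \<open>
  The tensor product of the spaces with bases \<open>'a\<close> and \<open>'b\<close> is the space with basis \<open>'a \<times> 'b\<close>.
  For monoid algebras, the monoid structure on pairs yields the componentwise product
  (lemma \<open>tensor_mult\<close>).
\<close>

lift_definition tensor :: "('a \<Rightarrow>\<^sub>0 rat) \<Rightarrow> ('b \<Rightarrow>\<^sub>0 rat) \<Rightarrow> ('a \<times> 'b \<Rightarrow>\<^sub>0 rat)" (infixl \<open>\<otimes>\<close> 75)
  is "\<lambda>a b (u, v). a u * b v"
proof -
  fix a :: "'a \<Rightarrow> rat" and b :: "'b \<Rightarrow> rat"
  assume "finite {x. a x \<noteq> 0}" "finite {x. b x \<noteq> 0}"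
  then have "finite ({x. a x \<noteq> 0} \<times> {x. b x \<noteq> 0})" by simp
  then show "finite {z. (case z of (u, v) \<Rightarrow> a u * b v) \<noteq> 0}"
    by (rule rev_finite_subset) auto
qed

definition tensor_map ::
    "(('a \<Rightarrow>\<^sub>0 rat) \<Rightarrow> ('c \<Rightarrow>\<^sub>0 rat)) \<Rightarrow> (('b \<Rightarrow>\<^sub>0 rat) \<Rightarrow> ('d \<Rightarrow>\<^sub>0 rat)) \<Rightarrow>
     ('a \<times> 'b \<Rightarrow>\<^sub>0 rat) \<Rightarrow> ('c \<times> 'd \<Rightarrow>\<^sub>0 rat)" where
  "tensor_map f g = lin_ext (\<lambda>(u, v). f (bas u) \<otimes> g (bas v))"

definition flip :: "('a \<times> 'b \<Rightarrow>\<^sub>0 rat) \<Rightarrow> ('b \<times> 'a \<Rightarrow>\<^sub>0 rat)" where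
  "flip = lin_ext (\<lambda>(u, v). bas v \<otimes> bas u)"

lemma lookup_tensor [simp]:
  "Poly_Mapping.lookup (a \<otimes> b) (u, v) = Poly_Mapping.lookup a u * Poly_Mapping.lookup b v"
  by transfer simp

lemma tensor_single: "Poly_Mapping.single u c \<otimes> Poly_Mapping.single v e = Poly_Mapping.single (u, v) (c * e)"
  by (rule poly_mapping_eqI) (auto simp: lookup_single when_def split: prod.splits if_splits)

lemma qlinear_tensor_left: "qlinear (\<lambda>a. a \<otimes> b)"
  and qlinear_tensor_right: "qlinear (\<lambda>b. a \<otimes> b)"
  by (auto simp: qlinear_iff lookup_add algebra_simps intro!: poly_mapping_eqI)

lemma qlinear_compose: "qlinear f \<Longrightarrow> qlinear g \<Longrightarrow> qlinear (\<lambda>a. f (g a))"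
  by (simp add: qlinear_iff)

lemma bilinear_ext:
  assumes "\<And>b. qlinear (\<lambda>a. B a b)" "\<And>a. qlinear (B a)"
    and "\<And>b. qlinear (\<lambda>a. C a b)" "\<And>a. qlinear (C a)"
    and "\<And>u v. B (bas u) (bas v) = C (bas u) (bas v)"
  shows "B a b = C a b"
proof -
  have "B (bas u) = C (bas u)" for u
    by (rule qlinear_ext) (use assms in auto)
  then have "(\<lambda>a. B a b) = (\<lambda>a. C a b)"
    by (intro qlinear_ext) (use assms in auto)
  then show ?thesis by meson
qed

theorem tensor_universal:
  fixes B :: "('a \<Rightarrow>\<^sub>0 rat) \<Rightarrow> ('b \<Rightarrow>\<^sub>0 rat) \<Rightarrow> ('c \<Rightarrow>\<^sub>0 rat)"
  assumes "\<And>b. qlinear (\<lambda>a. B a b)" "\<And>a. qlinear (B a)"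
  shows "\<exists>!L. qlinear L \<and> (\<forall>a b. L (a \<otimes> b) = B a b)"
proof (rule ex_ex1I)
  define L where "L = lin_ext (\<lambda>(u, v). B (bas u) (bas v))"
  have L: "qlinear L" by (simp add: L_def qlinear_lin_ext)
  have "L (a \<otimes> b) = B a b" for a b
    by (rule bilinear_ext[where B = "\<lambda>a b. L (a \<otimes> b)"])
       (auto intro: qlinear_compose[OF qlinear_lin_ext] qlinear_tensor_left qlinear_tensor_right assms
             simp: tensor_single L_def)
  then show "\<exists>L. qlinear L \<and> (\<forall>a b. L (a \<otimes> b) = B a b)" using L by blast
next
  fix L L' assume "qlinear L \<and> (\<forall>a b. L (a \<otimes> b) = B a b)" "qlinear L' \<and> (\<forall>a b. L' (a \<otimes> b) = B a b)"
  moreover have "bas w = bas (fst w) \<otimes> bas (snd w)" for w :: "'a \<times> 'b"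
    by (simp add: tensor_single)
  ultimately show "L = L'" by (intro qlinear_ext) (metis+)
qed

lemma tensor_map_tensor [simp]:
  assumes "qlinear f" "qlinear g"
  shows "tensor_map f g (a \<otimes> b) = f a \<otimes> g b"
  by (rule bilinear_ext[where B = "\<lambda>a b. tensor_map f g (a \<otimes> b)"])
     (auto intro: qlinear_compose[OF qlinear_lin_ext] qlinear_tensor_left qlinear_tensor_right
        qlinear_compose[OF qlinear_tensor_left assms(1)] qlinear_compose[OF qlinear_tensor_right assms(2)]
        simp: tensor_map_def tensor_single)

lemma flip_tensor [simp]: "flip (a \<otimes> b) = b \<otimes> a"
  by (rule bilinear_ext[where B = "\<lambda>a b. flip (a \<otimes> b)"])
     (auto intro: qlinear_compose[OF qlinear_lin_ext] qlinear_tensor_left qlinear_tensor_right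
        simp: flip_def tensor_single)

lemma qlinear_mult_left: "qlinear (\<lambda>a. a * (b :: 'a::monoid_add \<Rightarrow>\<^sub>0 rat))"
  by (simp add: qlinear_iff qscale_conv_mult algebra_simps)

lemma qlinear_mult_right: "qlinear (\<lambda>b. (a :: 'a::monoid_add \<Rightarrow>\<^sub>0 rat) * b)"
proof -
  have "a * qscale c b = qscale c (a * b)" for c b
  proof -
    have "qlinear (qscale c :: ('a \<Rightarrow>\<^sub>0 rat) \<Rightarrow> _)"
      by (auto simp: qlinear_iff lookup_add algebra_simps intro!: poly_mapping_eqI)
    then have "(\<lambda>a. a * Poly_Mapping.single 0 c) = (qscale c :: ('a \<Rightarrow>\<^sub>0 rat) \<Rightarrow> _)"
      by (intro qlinear_ext qlinear_mult_left) (simp_all add: mult_single)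
    then have "a * Poly_Mapping.single 0 c = Poly_Mapping.single 0 c * a"
      by (metis qscale_conv_mult)
    then show ?thesis by (simp add: qscale_conv_mult mult.assoc[symmetric])
  qed
  then show ?thesis by (simp add: qlinear_iff algebra_simps)
qed

lemma tensor_mult:
  fixes a c :: "'a::monoid_add \<Rightarrow>\<^sub>0 rat" and b e :: "'b::monoid_add \<Rightarrow>\<^sub>0 rat"
  shows "(a \<otimes> b) * (c \<otimes> e) = (a * c) \<otimes> (b * e)"
proof (rule bilinear_ext[where B = "\<lambda>a b. (a \<otimes> b) * (c \<otimes> e)"])
  fix u :: 'a and v :: 'b
  show "(bas u \<otimes> bas v) * (c \<otimes> e) = (bas u * c) \<otimes> (bas v * e)"
    by (rule bilinear_ext[where B = "\<lambda>c e. (bas u \<otimes> bas v) * (c \<otimes> e)"])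
       (auto intro: qlinear_compose[OF qlinear_mult_right] qlinear_tensor_left qlinear_tensor_right
          qlinear_compose[OF qlinear_tensor_left qlinear_mult_right]
          qlinear_compose[OF qlinear_tensor_right qlinear_mult_right]
          simp: tensor_single mult_single)
qed (auto intro: qlinear_compose[OF qlinear_mult_left] qlinear_tensor_left qlinear_tensor_right
          qlinear_compose[OF qlinear_tensor_left qlinear_mult_left]
          qlinear_compose[OF qlinear_tensor_right qlinear_mult_left])


section \<open>The free algebra \<open>\<HH> = \<rat>\<langle>p, y\<rangle>\<close>\<close>

text \<open>Words form the free monoid under concatenation, so \<open>'l list \<Rightarrow>\<^sub>0 rat\<close> is the free algebra on \<open>'l\<close>.\<close>

instantiation list :: (type) monoid_add
begin
definition zero_list :: "'a list" where "0 = []"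
definition plus_list :: "'a list \<Rightarrow> 'a list \<Rightarrow> 'a list" where "xs + ys = xs @ ys"
instance by standard (simp_all add: zero_list_def plus_list_def)
end

datatype letter = LP | LY

type_synonym hfree = "letter list \<Rightarrow>\<^sub>0 rat"

abbreviation hp :: hfree where "hp \<equiv> bas [LP]"
abbreviation hy :: hfree where "hy \<equiv> bas [LY]"

definition H1 :: "hfree set" where
  "H1 = {qscale c 1 + v * hy | c v. True}"

definition H0 :: "hfree set" where
  "H0 = {qscale c 1 + hp * v * hy | c v. True}"

fun swap_letter :: "letter \<Rightarrow> letter" where
  "swap_letter LP = LY"
| "swap_letter LY = LP"

definition tau :: "hfree \<Rightarrow> hfree" where
  "tau = lin_ext (\<lambda>w. bas (rev (map swap_letter w)))"

lemma qlinear_tau: "qlinear tau"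
  by (simp add: tau_def qlinear_lin_ext)

lemma tau_mult: "tau (a * b) = tau b * tau a"
  by (rule bilinear_ext[where B = "\<lambda>a b. tau (a * b)"])
     (auto intro: qlinear_compose[OF qlinear_lin_ext] qlinear_mult_left qlinear_mult_right
        qlinear_compose[OF qlinear_mult_left qlinear_lin_ext]
        qlinear_compose[OF qlinear_mult_right qlinear_lin_ext]
        simp: tau_def mult_single plus_list_def)

lemma tau_simps [simp]: "tau 1 = 1" "tau hp = hy" "tau hy = hp"
  by (simp_all flip: single_one add: tau_def zero_list_def)

lemma tau_tau: "tau (tau a) = a"
proof -
  have "swap_letter \<circ> swap_letter = id"
    by (rule ext) (metis comp_apply id_apply swap_letter.elims swap_letter.simps)
  then have "(\<lambda>a. tau (tau a)) = (\<lambda>a. a)"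
    by (intro qlinear_ext qlinear_compose[OF qlinear_tau] qlinear_tau)
       (auto simp: tau_def rev_map qlinear_iff)
  then show ?thesis by meson
qed


section \<open>Deconcatenation\<close>

definition zgen :: "nat \<Rightarrow> hfree" where
  "zgen k = hp ^ k * hy"

definition zword :: "nat list \<Rightarrow> letter list" where
  "zword ks = concat (map (\<lambda>k. replicate k LP @ [LY]) ks)"

text \<open>
  \<open>Delta\<close> is given on the basis of \<open>H1\<close> formed by the words in the \<open>zgen k\<close>; it is a map with domain
  \<open>H1\<close>, and words that are not in \<open>H1\<close> are sent to the dummy value \<open>0\<close>.
\<close>

definition Delta :: "hfree \<Rightarrow> (letter list \<times> letter list \<Rightarrow>\<^sub>0 rat)" where
  "Delta = lin_ext (\<lambda>w. if w \<in> range zword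
     then let ks = inv zword w in \<Sum>l\<le>length ks. bas (zword (take l ks)) \<otimes> bas (zword (drop l ks))
     else 0)"

lemma bas_zword: "bas (zword ks) = prod_list (map zgen ks)"
proof -
  have "hp ^ k = bas (replicate k LP)" for k
    by (induction k) (simp_all add: mult_single plus_list_def zero_list_def flip: single_one)
  then have "zgen k = bas (replicate k LP @ [LY])" for k
    by (simp add: zgen_def mult_single plus_list_def)
  moreover have "bas (u @ v) = bas u * bas v" for u v :: "letter list"
    by (simp add: mult_single plus_list_def)
  ultimately show ?thesis
    by (induction ks) (simp_all only: zword_def list.map concat.simps prod_list.Nil prod_list.Cons,
      simp flip: single_one add: zero_list_def)
qed

lemma inj_zword: "inj zword"
proof (rule injI)
  fix ks ls show "zword ks = zword ls \<Longrightarrow> ks = ls"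
  proof (induction ks arbitrary: ls)
    case Nil then show ?case by (cases ls) (auto simp: zword_def)
  next
    case (Cons k ks)
    then obtain l ls' where ls: "ls = l # ls'" by (cases ls) (auto simp: zword_def)
    have *: "replicate k LP @ LY # u = replicate l LP @ LY # v \<Longrightarrow> k = l \<and> u = v" for k l u v
    proof (induction k arbitrary: l)
      case 0 then show ?case by (cases l) auto
    next
      case (Suc k) then show ?case by (cases l) auto
    qed
    have "k = l \<and> zword ks = zword ls'"
      by (rule *) (use Cons.prems ls in \<open>simp add: zword_def\<close>)
    then show ?case using Cons.IH ls by simp
  qed
qed

lemma range_zword_iff: "w \<in> range zword \<longleftrightarrow> w = [] \<or> (\<exists>u. w = u @ [LY])"
proof
  assume "w \<in> range zword"
  then obtain ks where w: "w = zword ks" ..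
  show "w = [] \<or> (\<exists>u. w = u @ [LY])"
    by (cases ks rule: rev_cases) (auto simp: w zword_def)
next
  have "\<exists>ks. u @ [LY] = zword ks" for u
  proof (induction u)
    case Nil
    show ?case by (rule exI[of _ "[0]"]) (simp add: zword_def)
  next
    case (Cons x u)
    then obtain k ks where ks: "u @ [LY] = zword (k # ks)"
      by (metis Nil_is_append_conv concat.simps(1) list.exhaust list.simps(8) not_Cons_self2 zword_def)
    show ?case
    proof (cases x)
      case LP
      then show ?thesis using ks by (intro exI[of _ "Suc k # ks"]) (simp add: zword_def)
    next
      case LY
      then show ?thesis using ks by (intro exI[of _ "0 # k # ks"]) (simp add: zword_def)
    qed
  qed
  moreover have "[] = zword []" by (simp add: zword_def)
  ultimately show "w = [] \<or> (\<exists>u. w = u @ [LY]) \<Longrightarrow> w \<in> range zword" by blast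
qed

theorem H1_iff_keys: "a \<in> H1 \<longleftrightarrow> Poly_Mapping.keys a \<subseteq> range zword"
proof
  assume "a \<in> H1"
  then obtain c v where a: "a = qscale c 1 + v * hy" by (auto simp: H1_def)
  have "Poly_Mapping.keys (v * hy) \<subseteq> {u @ [LY] | u. True}"
    using keys_mult[of v hy] by (auto simp: plus_list_def)
  moreover have "Poly_Mapping.keys (qscale c 1 :: hfree) \<subseteq> {[]}"
    by (simp flip: single_one add: zero_list_def)
  ultimately show "Poly_Mapping.keys a \<subseteq> range zword"
    using keys_add[of "qscale c 1" "v * hy"] unfolding a range_zword_iff subset_iff by blast
next
  assume a: "Poly_Mapping.keys a \<subseteq> range zword"
  have add: "x + y \<in> H1" if xy: "x \<in> H1" "y \<in> H1" for x y
  proof -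
    obtain c v e w where "x = qscale c 1 + v * hy" "y = qscale e 1 + w * hy"
      using xy by (auto simp: H1_def)
    then have "x + y = qscale (c + e) 1 + (v + w) * hy"
      by (simp add: qscale_conv_mult single_add algebra_simps)
    then show ?thesis unfolding H1_def by blast
  qed
  have zero: "0 \<in> H1"
    unfolding H1_def by (simp add: qscale_conv_mult) (metis add_0 mult_zero_left single_zero)
  have "qscale c (bas w) \<in> H1" if w: "w \<in> range zword" for c w
  proof (cases "w = []")
    case True
    then have "qscale c (bas w) = qscale c 1 + 0 * hy" by (simp add: zero_list_def flip: single_one)
    then show ?thesis unfolding H1_def by blast
  next
    case False
    then obtain u where "w = u @ [LY]" using w unfolding range_zword_iff by blast
    then have "qscale c (bas w) = qscale 0 1 + Poly_Mapping.single u c * hy"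
      by (simp add: mult_single plus_list_def qscale_conv_mult[of 0])
    then show ?thesis unfolding H1_def by blast
  qed
  note scaled = this
  have "(\<Sum>w\<in>A. qscale (Poly_Mapping.lookup a w) (bas w)) \<in> H1"
    if "finite A" "A \<subseteq> range zword" for A
    using that by (induction A rule: finite_induct) (auto simp: zero intro!: add scaled simp del: qscale_single)
  then show "a \<in> H1" using a sum_bas[of a] by (metis finite_keys)
qed

lemma tau_H0: "w \<in> H0 \<Longrightarrow> tau w \<in> H0"
  and H0_subset_H1: "H0 \<subseteq> H1"
proof -
  show "H0 \<subseteq> H1" by (auto simp: H0_def H1_def)
  assume "w \<in> H0"
  then obtain c v where "w = qscale c 1 + hp * v * hy" by (auto simp: H0_def)
  then have "tau w = qscale c 1 + hp * tau v * hy"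
    using qlinear_tau by (simp add: qlinear_iff tau_mult mult.assoc)
  then show "tau w \<in> H0" by (auto simp: H0_def)
qed

theorem Delta_prod_zgen:
  "Delta (prod_list (map zgen ks)) =
     (\<Sum>l\<le>length ks. prod_list (map zgen (take l ks)) \<otimes> prod_list (map zgen (drop l ks)))"
  by (simp flip: bas_zword add: Delta_def inv_f_f[OF inj_zword])

lemma qlinear_Delta: "qlinear Delta"
  by (simp add: Delta_def qlinear_lin_ext)


section \<open>The algebra \<open>\<H>\<close>\<close>

text \<open>
  The relations \<open>pd = dp = 1\<close> identify words with words, so the quotient of \<open>\<rat>\<langle>p, d, y\<rangle>\<close> by them is
  the monoid algebra of the monoid \<open>mon\<close> of words modulo the congruence they generate.
\<close>

datatype mletter = MP | MD | MY

inductive mcong :: "mletter list \<Rightarrow> mletter list \<Rightarrow> bool" where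
  refl: "mcong u u"
| sym: "mcong u v \<Longrightarrow> mcong v u"
| trans: "mcong u v \<Longrightarrow> mcong v w \<Longrightarrow> mcong u w"
| pd: "mcong (u @ [MP, MD] @ v) (u @ v)"
| dp: "mcong (u @ [MD, MP] @ v) (u @ v)"

lemma mcong_append_right: "mcong u v \<Longrightarrow> mcong (u @ w) (v @ w)"
proof (induction rule: mcong.induct)
  case (pd u v) show ?case using mcong.pd[of u "v @ w"] by simp
next
  case (dp u v) show ?case using mcong.dp[of u "v @ w"] by simp
qed (blast intro: mcong.refl mcong.sym mcong.trans)+

lemma mcong_append_left: "mcong u v \<Longrightarrow> mcong (w @ u) (w @ v)"
proof (induction rule: mcong.induct)
  case (pd u v) show ?case using mcong.pd[of "w @ u" v] by simp
next
  case (dp u v) show ?case using mcong.dp[of "w @ u" v] by simp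
qed (blast intro: mcong.refl mcong.sym mcong.trans)+

quotient_type mon = "mletter list" / mcong
  by (intro equivpI reflpI sympI transpI) (fact mcong.refl, erule mcong.sym, erule (1) mcong.trans)

instantiation mon :: monoid_add
begin
lift_definition zero_mon :: mon is "[]" .
lift_definition plus_mon :: "mon \<Rightarrow> mon \<Rightarrow> mon" is "(@)"
  by (meson mcong.trans mcong_append_left mcong_append_right)
instance by standard (transfer, simp add: mcong.refl)+
end

lift_definition mon_of :: "mletter list \<Rightarrow> mon" is "\<lambda>u. u" .

type_synonym hcal = "mon \<Rightarrow>\<^sub>0 rat"

abbreviation cp :: hcal where "cp \<equiv> bas (mon_of [MP])"
abbreviation cd :: hcal where "cd \<equiv> bas (mon_of [MD])"
abbreviation cy :: hcal where "cy \<equiv> bas (mon_of [MY])"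

fun emb_letter :: "letter \<Rightarrow> mletter" where
  "emb_letter LP = MP"
| "emb_letter LY = MY"

definition incl :: "hfree \<Rightarrow> hcal" where
  "incl = lin_ext (\<lambda>w. bas (mon_of (map emb_letter w)))"

lemma mon_of_append: "mon_of (u @ v) = mon_of u + mon_of v"
  by transfer (rule mcong.refl)

lemma mon_of_Nil: "mon_of [] = 0"
  by transfer (rule mcong.refl)

lemma mon_of_eq_iff: "mon_of u = mon_of v \<longleftrightarrow> mcong u v"
  by transfer simp

lemma mon_of_surj: "\<exists>u. m = mon_of u"
  by transfer (blast intro: mcong.refl)

lemma cp_cd: "cp * cd = 1" "cd * cp = 1"
proof -
  have "mon_of [MP, MD] = mon_of []" "mon_of [MD, MP] = mon_of []"
    using mcong.pd[of "[]" "[]"] mcong.dp[of "[]" "[]"] by (simp_all add: mon_of_eq_iff)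
  then show "cp * cd = 1" "cd * cp = 1"
    by (simp_all add: mult_single mon_of_Nil flip: single_one mon_of_append)
qed

lemma qlinear_incl: "qlinear incl"
  by (simp add: incl_def qlinear_lin_ext)

lemma incl_mult: "incl (a * b) = incl a * incl b"
  by (rule bilinear_ext[where B = "\<lambda>a b. incl (a * b)"])
     (auto intro: qlinear_compose[OF qlinear_lin_ext] qlinear_mult_left qlinear_mult_right
        qlinear_compose[OF qlinear_mult_left qlinear_lin_ext]
        qlinear_compose[OF qlinear_mult_right qlinear_lin_ext]
        simp: incl_def mult_single plus_list_def mon_of_append)

lemma incl_simps [simp]: "incl 1 = 1" "incl hp = cp" "incl hy = cy"
  by (simp_all flip: single_one add: incl_def zero_list_def mon_of_Nil)

text \<open>Left multiplication by a letter on reduced words, used to see that \<open>incl\<close> is injective.\<close>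

fun act :: "mletter \<Rightarrow> mletter list \<Rightarrow> mletter list" where
  "act MP (MD # w) = w"
| "act MD (MP # w) = w"
| "act x w = x # w"

fun reduced :: "mletter list \<Rightarrow> bool" where
  "reduced (MP # MD # w) = False"
| "reduced (MD # MP # w) = False"
| "reduced (x # w) = reduced w"
| "reduced [] = True"

lemma reduced_act: "reduced w \<Longrightarrow> reduced (act x w)"
  by (cases "(x, w)" rule: act.cases; cases w rule: reduced.cases) auto

lemma reduced_foldr: "reduced w \<Longrightarrow> reduced (foldr act u w)"
  by (induction u) (auto simp: reduced_act)

lemma act_cancel: "reduced w \<Longrightarrow> act MP (act MD w) = w" "reduced w \<Longrightarrow> act MD (act MP w) = w"
proof -
  assume w: "reduced w"
  have "act MP (act MD w) = w \<and> act MD (act MP w) = w"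
  proof (cases w)
    case (Cons x v)
    then show ?thesis using w by (cases x; cases v; cases "hd v") auto
  qed simp
  then show "act MP (act MD w) = w" "act MD (act MP w) = w" by simp_all
qed

lemma mcong_foldr: "mcong u v \<Longrightarrow> foldr act u [] = foldr act v []"
  by (induction rule: mcong.induct) (auto simp: act_cancel reduced_foldr)

lemma foldr_act_emb: "foldr act (map emb_letter w) [] = map emb_letter w"
proof (induction w)
  case (Cons x w)
  then show ?case by (cases x; cases w; cases "hd w") auto
qed simp

theorem inj_incl: "inj incl"
proof (rule injI)
  have emb: "inj emb_letter"
    by (rule injI) (metis emb_letter.elims mletter.distinct)
  have inj: "mon_of (map emb_letter u) = mon_of (map emb_letter v) \<longleftrightarrow> u = v" for u v
    using mcong_foldr[of "map emb_letter u" "map emb_letter v"]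
    by (auto simp: mon_of_eq_iff foldr_act_emb inj_map_eq_map[OF emb] mcong.refl)
  fix a b assume "incl a = incl b"
  have *: "Poly_Mapping.lookup (incl a) (mon_of (map emb_letter w)) = Poly_Mapping.lookup a w" for a w
    by (simp add: incl_def lin_ext_def lookup_sum lookup_single when_def inj in_keys_iff)
  show "a = b"
    by (rule poly_mapping_eqI) (metis * \<open>incl a = incl b\<close>)
qed


section \<open>The map \<open>Delta_bar\<close>\<close>

definition is_Delta_bar :: "(hcal \<Rightarrow> (mon \<times> mon \<Rightarrow>\<^sub>0 rat)) \<Rightarrow> bool" where
  "is_Delta_bar D \<longleftrightarrow> qlinear D \<and>
     D 1 = 1 \<otimes> 1 \<and>
     D cp = cp \<otimes> 1 + 1 \<otimes> cp \<and>
     D cy = cy \<otimes> 1 \<and>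
     D cd = 0 \<and>
     (\<forall>u v. D (u * v) = (u \<otimes> 1) * D v + D u * (1 \<otimes> v) - u \<otimes> v)"

definition Delta_bar :: "hcal \<Rightarrow> (mon \<times> mon \<Rightarrow>\<^sub>0 rat)" where
  "Delta_bar = (THE D. is_Delta_bar D)"

fun Dlet :: "mletter \<Rightarrow> (mon \<times> mon \<Rightarrow>\<^sub>0 rat)" where
  "Dlet MP = cp \<otimes> 1 + 1 \<otimes> cp"
| "Dlet MY = cy \<otimes> 1"
| "Dlet MD = 0"

abbreviation mb :: "mletter list \<Rightarrow> hcal" where "mb u \<equiv> bas (mon_of u)"

fun Dword :: "mletter list \<Rightarrow> (mon \<times> mon \<Rightarrow>\<^sub>0 rat)" where
  "Dword [] = 1 \<otimes> 1"
| "Dword (x # v) = (mb [x] \<otimes> 1) * Dword v + Dlet x * (1 \<otimes> mb v) - mb [x] \<otimes> mb v"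

lemma mb_append: "mb (u @ v) = mb u * mb v"
  by (simp add: mult_single mon_of_append)

lemma mb_Cons: "mb (x # v) = mb [x] * mb v"
  using mb_append[of "[x]" v] by simp

lemma mb_Nil: "mb [] = 1"
  by (simp add: mon_of_Nil flip: single_one)

lemma one_tensor_one: "(1 :: 'a::monoid_add \<Rightarrow>\<^sub>0 rat) \<otimes> (1 :: 'b::monoid_add \<Rightarrow>\<^sub>0 rat) = 1"
  by (simp flip: single_one add: tensor_single zero_prod_def)

lemma Dword_append: "Dword (u @ v) = (mb u \<otimes> 1) * Dword v + Dword u * (1 \<otimes> mb v) - mb u \<otimes> mb v"
proof (induction u)
  case Nil
  show ?case by (simp add: mb_Nil one_tensor_one)
next
  case (Cons x u)
  have 1: "(mb [x] \<otimes> 1) * ((mb u \<otimes> 1) * X) = (mb (x # u) \<otimes> 1) * X"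
    for X :: "mon \<times> mon \<Rightarrow>\<^sub>0 rat"
    by (simp add: tensor_mult mb_Cons[of x u] flip: mult.assoc)
  have 2: "X * (1 \<otimes> mb (u @ v)) = X * (1 \<otimes> mb u) * (1 \<otimes> mb v)"
    for X :: "mon \<times> mon \<Rightarrow>\<^sub>0 rat"
    by (simp only: mult.assoc tensor_mult mb_append mult_1_left)
  have 3: "(mb [x] \<otimes> 1) * (mb u \<otimes> mb v) = mb (x # u) \<otimes> mb v"
    by (simp only: tensor_mult mb_Cons[of x u] mult_1_left)
  have 4: "mb [x] \<otimes> mb (u @ v) = (mb [x] \<otimes> mb u) * (1 \<otimes> mb v)"
    by (simp only: tensor_mult mb_append mult_1_right)
  show ?case
    by (simp only: append_Cons Dword.simps Cons.IH 2 4) (simp only: algebra_simps 1 3)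
qed

lemma Dword_mcong: "mcong u v \<Longrightarrow> Dword u = Dword v"
proof (induction rule: mcong.induct)
  have mb: "mb [MP, MD] = 1" "mb [MD, MP] = 1"
    using cp_cd by (simp_all add: mb_Cons[of _ "[_]"])
  have one: "Dword [MP, MD] = 1" "Dword [MD, MP] = 1"
    by (simp_all add: mb_Nil one_tensor_one algebra_simps tensor_mult cp_cd)
  have *: "Dword (w @ v) = Dword v" if "mb w = 1" "Dword w = 1" for w v
    by (simp only: Dword_append that one_tensor_one) simp
  have m: "mb (w @ v) = mb v" if "mb w = 1" for w v
    by (simp only: mb_append that mult_1_left)
  {
    case (pd u v)
    show ?case by (simp only: Dword_append[of u] *[OF mb(1) one(1)] m[OF mb(1)])
  next
    case (dp u v)
    show ?case by (simp only: Dword_append[of u] *[OF mb(2) one(2)] m[OF mb(2)])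
  }
qed simp_all

theorem ex1_Delta_bar: "\<exists>!D. is_Delta_bar D"
proof (rule ex_ex1I)
  define D where "D = lin_ext (\<lambda>m. Dword (SOME u. m = mon_of u))"
  have lin: "qlinear D" by (simp add: D_def qlinear_lin_ext)
  have D: "D (mb u) = Dword u" for u
  proof -
    have "mon_of u = mon_of (SOME w. mon_of u = mon_of w)" by (rule someI) simp
    then show ?thesis using Dword_mcong by (simp add: D_def mon_of_eq_iff)
  qed
  have "D (u * v) = (u \<otimes> 1) * D v + D u * (1 \<otimes> v) - u \<otimes> v" for u v
  proof (rule bilinear_ext[where B = "\<lambda>u v. D (u * v)"])
    fix m n
    obtain u v where "m = mon_of u" "n = mon_of v" using mon_of_surj by meson
    then show "D (bas m * bas n) = (bas m \<otimes> 1) * D (bas n) + D (bas m) * (1 \<otimes> bas n) - bas m \<otimes> bas n"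
      by (simp only: D Dword_append flip: mb_append)
  next
    fix v
    show "qlinear (\<lambda>u. D (u * v))" by (intro qlinear_compose[OF lin] qlinear_mult_left)
    show "qlinear (\<lambda>v'. D (v * v'))" by (intro qlinear_compose[OF lin] qlinear_mult_right)
    have sc: "qscale c a + qscale c b - qscale c e = qscale c (a + b - e)" for c and a b e :: "mon \<times> mon \<Rightarrow>\<^sub>0 rat"
      by (rule poly_mapping_eqI) (simp add: lookup_add lookup_minus algebra_simps)
    have sub: "qlinear (\<lambda>a. f a + g a - h a)" if "qlinear f" "qlinear g" "qlinear h"
      for f g h :: "hcal \<Rightarrow> (mon \<times> mon \<Rightarrow>\<^sub>0 rat)"
      using that by (simp add: qlinear_iff sc)
    show "qlinear (\<lambda>u. (u \<otimes> 1) * D v + D u * (1 \<otimes> v) - u \<otimes> v)"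
      by (intro sub qlinear_tensor_left qlinear_compose[OF qlinear_mult_left] lin)
    show "qlinear (\<lambda>v'. (v \<otimes> 1) * D v' + D v * (1 \<otimes> v') - v \<otimes> v')"
      by (intro sub qlinear_tensor_right qlinear_compose[OF qlinear_mult_right] lin)
  qed
  moreover have "D (mb [x]) = Dlet x" for x
    by (simp only: D Dword.simps mb_Nil one_tensor_one) simp
  moreover have "D 1 = 1 \<otimes> 1" using D[of "[]"] by (simp add: mb_Nil)
  ultimately have "is_Delta_bar D" using lin by (simp add: is_Delta_bar_def)
  then show "\<exists>D. is_Delta_bar D" by blast
next
  fix D E assume DE: "is_Delta_bar D" "is_Delta_bar E"
  have letter: "D (mb [x]) = E (mb [x])" for x
    using DE by (cases x) (auto simp: is_Delta_bar_def)
  have "D (mb u) = E (mb u)" for u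
  proof (induction u)
    case Nil show ?case using DE by (simp add: is_Delta_bar_def mb_Nil)
  next
    case (Cons x u)
    have "D (mb [x] * mb u) = E (mb [x] * mb u)"
      using DE letter[of x] Cons unfolding is_Delta_bar_def by metis
    then show ?case by (simp only: mb_Cons[of x u])
  qed
  then have "D (bas m) = E (bas m)" for m using mon_of_surj by metis
  then show "D = E" using DE by (intro qlinear_ext) (auto simp: is_Delta_bar_def)
qed

lemma is_Delta_bar_Delta_bar: "is_Delta_bar Delta_bar"
  unfolding Delta_bar_def by (rule theI'[of is_Delta_bar, OF ex1_Delta_bar])

end

theory Submission
  imports Defs
begin

text \<open>
  The words \<open>p y\<^sup>k\<close> are primitive for \<open>Delta_bar\<close>, and on a product of primitive elements the defining
  rule of \<open>Delta_bar\<close> unfolds to deconcatenation into these factors.  Since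
  \<open>tau (zgen k) = p y\<^sup>k\<close> and \<open>tau\<close> reverses products, conjugating \<open>Delta\<close> by \<open>tau\<close> and flipping gives
  the same deconcatenation.
\<close>

text \<open>\<open>Delta\<close> takes the dummy value \<open>0\<close> on words outside
  \<open>range zword\<close>, so the two sides of the main identity can be compared only on the
  words that actually occur in the argument.\<close>

lemma qlinear_eq_on_keys:
  assumes f: "qlinear f" and g: "qlinear g"
    and eq: "\<And>w. w \<in> Poly_Mapping.keys a \<Longrightarrow> f (bas w) = g (bas w)"
  shows "f a = g a"
proof -
  have *: "h a = (\<Sum>w\<in>Poly_Mapping.keys a. qscale (Poly_Mapping.lookup a w) (h (bas w)))"
    if "qlinear h" for h :: "('a \<Rightarrow>\<^sub>0 rat) \<Rightarrow> ('b \<Rightarrow>\<^sub>0 rat)"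
    by (subst (1) sum_bas[of a, symmetric], subst qlinear_sum[OF that])
       (use that in \<open>simp add: qlinear_iff del: qscale_single\<close>)
  show ?thesis
    by (simp add: *[OF f] *[OF g] eq)
qed

lemma qlinear_Delta_bar: "qlinear Delta_bar"
  and Delta_bar_one: "Delta_bar 1 = 1 \<otimes> 1"
  and Delta_bar_cp: "Delta_bar cp = cp \<otimes> 1 + 1 \<otimes> cp"
  and Delta_bar_cy: "Delta_bar cy = cy \<otimes> 1"
  and Delta_bar_mult: "Delta_bar (u * v) = (u \<otimes> 1) * Delta_bar v + Delta_bar u * (1 \<otimes> v) - u \<otimes> v"
  using is_Delta_bar_Delta_bar by (simp_all add: is_Delta_bar_def)

lemma Delta_bar_cy_power: "Delta_bar (cy ^ k) = cy ^ k \<otimes> 1"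
  by (induction k) (simp_all add: Delta_bar_one Delta_bar_mult Delta_bar_cy tensor_mult)

text \<open>The summand \<open>cp \<otimes> 1\<close> of \<open>Delta_bar cp\<close> produces
  \<open>cp \<otimes> cy ^ k\<close>, which the subtracted term of the product rule cancels.\<close>

lemma Delta_bar_cp_cy_power: "Delta_bar (cp * cy ^ k) = (cp * cy ^ k) \<otimes> 1 + 1 \<otimes> (cp * cy ^ k)"
  by (simp add: Delta_bar_mult Delta_bar_cp Delta_bar_cy_power tensor_mult distrib_right)

text \<open>The order is reversed to match \<open>tau\<close>; a new head \<open>u\<close> thus
  becomes the last factor of the product.\<close>

lemma Delta_bar_prod_list_rev:
  assumes "\<And>u. u \<in> set us \<Longrightarrow> Delta_bar u = u \<otimes> 1 + 1 \<otimes> u"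
  shows "Delta_bar (prod_list (rev us)) =
    (\<Sum>l\<le>length us. prod_list (rev (drop l us)) \<otimes> prod_list (rev (take l us)))"
  using assms
proof (induction us)
  case Nil
  show ?case by (simp add: Delta_bar_one)
next
  case (Cons u us)
  let ?X = "prod_list (rev us)"
  have "Delta_bar (?X * u) = (?X \<otimes> 1) * (u \<otimes> 1 + 1 \<otimes> u) + Delta_bar ?X * (1 \<otimes> u) - ?X \<otimes> u"
    using Cons.prems by (simp add: Delta_bar_mult)
  \<comment> \<open>Primitivity of \<open>u\<close> yields a mixed term
    \<open>?X \<otimes> u\<close> that cancels the subtracted one.\<close>
  also have "\<dots> = (?X * u) \<otimes> 1 + Delta_bar ?X * (1 \<otimes> u)"
    by (simp add: distrib_left tensor_mult)
  also have "Delta_bar ?X * (1 \<otimes> u) =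
      (\<Sum>l\<le>length us. prod_list (rev (drop l us)) \<otimes> (prod_list (rev (take l us)) * u))"
    using Cons by (simp add: sum_distrib_right tensor_mult)
  \<comment> \<open>The isolated term is the cut at \<open>l = 0\<close>; the cut at
    \<open>l\<close> of \<open>us\<close> becomes the cut at \<open>l + 1\<close> of
    \<open>u # us\<close>.\<close>
  finally show ?case
    by (simp add: sum.atMost_Suc_shift del: sum.atMost_Suc)
qed

lemma tau_prod_list: "tau (prod_list us) = prod_list (rev (map tau us))"
  by (induction us) (simp_all add: tau_mult)

lemma incl_prod_list: "incl (prod_list us) = prod_list (map incl us)"
  by (induction us) (simp_all add: incl_mult)

lemma incl_tau_zgen: "incl (tau (zgen k)) = cp * cy ^ k"
proof -
  have "tau (hp ^ k) = hy ^ k"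
    by (induction k) (simp_all add: tau_mult power_commutes)
  moreover have "incl (hy ^ k) = cy ^ k"
    by (induction k) (simp_all add: incl_mult)
  ultimately show ?thesis
    by (simp add: zgen_def tau_mult incl_mult)
qed

lemma qlinear_tensor_map: "qlinear (tensor_map f g)"
  and qlinear_flip: "qlinear flip"
  by (simp_all add: tensor_map_def flip_def qlinear_lin_ext)

lemma Delta_bar_incl_tau_zgen:
  "Delta_bar (incl (tau (prod_list (map zgen ks)))) =
    tensor_map incl incl (flip (tensor_map tau tau (Delta (prod_list (map zgen ks)))))"
proof -
  define us where "us = map (\<lambda>k. incl (tau (zgen k))) ks"
  \<comment> \<open>Kept general in \<open>ks'\<close> because it is applied to \<open>ks\<close>
    and to all its prefixes and suffixes; the two sums then agree term by term.\<close>
  have X: "incl (tau (prod_list (map zgen ks'))) = prod_list (rev (map (\<lambda>k. incl (tau (zgen k))) ks'))"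
    for ks'
    by (simp add: tau_prod_list incl_prod_list rev_map o_def)
  have "Delta_bar (prod_list (rev us)) =
      (\<Sum>l\<le>length us. prod_list (rev (drop l us)) \<otimes> prod_list (rev (take l us)))"
    by (rule Delta_bar_prod_list_rev) (auto simp: us_def incl_tau_zgen Delta_bar_cp_cy_power)
  then show ?thesis
    by (simp add: Delta_prod_zgen qlinear_sum[OF qlinear_tensor_map] qlinear_sum[OF qlinear_flip]
        qlinear_tau qlinear_incl X us_def take_map drop_map)
qed

theorem theorem6p3:
  fixes w :: hfree
  assumes "w \<in> H0"
  shows "Delta_bar (incl w) =
    tensor_map incl incl ((flip \<circ> tensor_map tau tau \<circ> Delta \<circ> tau) w)"
proof -
  have "tau w \<in> H1"
    using tau_H0[OF assms] H0_subset_H1 by blast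
  then have keys: "Poly_Mapping.keys (tau w) \<subseteq> range zword"
    by (simp add: H1_iff_keys)
  \<comment> \<open>Since \<open>tau\<close> is an involution, the claim becomes an identity of
    linear maps evaluated at \<open>tau w\<close>, a combination of products of the
    \<open>zgen k\<close>.\<close>
  have "Delta_bar (incl (tau (tau w))) =
      tensor_map incl incl (flip (tensor_map tau tau (Delta (tau w))))"
  proof (rule qlinear_eq_on_keys[where f = "\<lambda>a. Delta_bar (incl (tau a))"])
    show "qlinear (\<lambda>a. Delta_bar (incl (tau a)))"
      by (intro qlinear_compose[OF qlinear_Delta_bar] qlinear_compose[OF qlinear_incl] qlinear_tau)
    show "qlinear (\<lambda>a. tensor_map incl incl (flip (tensor_map tau tau (Delta a))))"
      by (intro qlinear_compose[OF qlinear_tensor_map] qlinear_compose[OF qlinear_flip] qlinear_Delta)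
  next
    fix v assume "v \<in> Poly_Mapping.keys (tau w)"
    then obtain ks where "v = zword ks" using keys by blast
    then show "Delta_bar (incl (tau (bas v))) =
        tensor_map incl incl (flip (tensor_map tau tau (Delta (bas v))))"
      by (simp only: bas_zword Delta_bar_incl_tau_zgen)
  qed
  then show ?thesis by (simp add: tau_tau)
qed

end
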